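(* Let $d\in\{2,3\}$, $k>0$, and let $D=\bigcup_{j=1}^J D_j$, $D_j=x_j+\epsilon B_j$, be a union of small volume regions contained in $\Omega\subset\mathbb{R}^d$, with source $\rho$, as described in the context, and suppose $\mathrm{Avg}(\rho_j)\neq0$ for $j=1,\dots,J$. Let $\mathcal{X}=\{x_j: j=1,\dots,J\}$. Then, up to leading order in $\epsilon$, i.e. with the direct sampling imaging functional $W$ replaced by the leading-order term of its expansion as $\epsilon\to0$, $$W(z)\simeq W_0(z):=\left|\epsilon^d\sum_{j=1}^J\mathrm{Avg}(\rho_j)\,|B_j|\int_{\mathbb{S}^{d-1}}e^{\mathrm{i}k(x_j-z)\cdot\hat y}\,ds(\hat y)\right|,$$ one has, for $z\in\mathbb{R}^d\setminus D$, $$W_0(z)=\mathcal{O}\Big(\mathrm{dist}(z,\mathcal{X})^{\frac{1-d}{2}}\Big)\quad\text{as }\mathrm{dist}(z,\mathcal{X})\to\infty.$$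
   Context: Geometry: $\Omega\subset\mathbb{R}^d$ is a bounded simply connected open set with Lipschitz boundary and unit outward normal $\nu$; $J\in\mathbb{N}$; $x_1,\dots,x_J\in\Omega$ with $|x_i-x_j|\ge c_0>0$ for $i\ne j$; each $B_j$ is a bounded domain with Lipschitz boundary, centered at the origin, $|B_j|=\mathcal{O}(1)$; $0<\epsilon\ll1$; $D_j=x_j+\epsilon B_j$, the $D_j$ are pairwise disjoint, and $\mathrm{dist}(D,\partial\Omega)>0$. $\rho\in L^\infty(D)$ and $\mathrm{Avg}(\rho_j)=|D_j|^{-1}\int_{D_j}\rho\,dx$. Imaging functional: $k^2$ is not a Dirichlet eigenvalue of $-\Delta$ in $\Omega$; for $f\in H^{1/2}(\partial\Omega)$, $u^s\in H^1(\Omega)$ solves $\Delta u^s+k^2u^s=\rho\chi_D$ in $\Omega$, $u^s|_{\partial\Omega}=f$; for $v$ solving $\Delta v+k^2v=0$ in $\Omega$, $R[v]=\int_{\partial\Omega}v\,\partial_\nu u^s-u^s\,\partial_\nu v\,ds$. For $\hat y\in\mathbb{S}^{d-1}$ (the unit circle/sphere), $R[e^{\mathrm{i}k\,\cdot\,\hat y}]$ denotes $R$ applied to the plane wave $x\mapsto e^{\mathrm{i}kx\cdot\hat y}$, regarded as a function of $\hat y$, and $$W(z)=\Big|\int_{\mathbb{S}^{d-1}}R[e^{\mathrm{i}k\,\cdot\,\hat y}]\;\overline{e^{\mathrm{i}kz\cdot\hat y}}\,ds(\hat y)\Big|,\qquad z\in\mathbb{R}^d.$$ One has $W(z)=W_0(z)+\mathcal{O}(\epsilon^{d+1})$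 as $\epsilon\to0$. *)

theory Defs
  imports "HOL-Analysis.Analysis" "HOL-Library.Landau_Symbols"
begin

text \<open>
  A set has Lipschitz boundary if, near every boundary point, it is the region strictly above the
  graph of a Lipschitz function over some hyperplane \<open>{y. y \<bullet> e = 0}\<close>.
\<close>

definition lipschitz_boundary :: "'a::euclidean_space set \<Rightarrow> bool" where
  "lipschitz_boundary S \<longleftrightarrow>
     (\<forall>p \<in> frontier S. \<exists>U e \<phi> L. open U \<and> p \<in> U \<and> norm e = 1 \<and>
        L-lipschitz_on {y. y \<bullet> e = 0} \<phi> \<and>
        S \<inter> U = {x \<in> U. \<phi> (x - (x \<bullet> e) *\<^sub>R e) < x \<bullet> e})"

definition bounded_lipschitz_domain :: "'a::euclidean_space set \<Rightarrow> bool" where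
  "bounded_lipschitz_domain S \<longleftrightarrow>
     S \<noteq> {} \<and> open S \<and> connected S \<and> bounded S \<and> lipschitz_boundary S"

text \<open>
  ``Centered at the origin'' is used in the literature on small inhomogeneities both for reference
  domains with barycentre \<open>0\<close> and for reference domains merely containing \<open>0\<close>;
  both conventions are admitted.
\<close>

definition centered_at_origin :: "'a::euclidean_space set \<Rightarrow> bool" where
  "centered_at_origin S \<longleftrightarrow> 0 \<in> S \<or> (LINT x:S|lebesgue. x) = 0"

definition region :: "real \<Rightarrow> 'a::euclidean_space \<Rightarrow> 'a set \<Rightarrow> 'a set" where
  "region \<epsilon> c S = (\<lambda>y. c + \<epsilon> *\<^sub>R y) ` S"

definition Linfty_on :: "'a::euclidean_space set \<Rightarrow> ('a \<Rightarrow> complex) \<Rightarrow> bool" where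
  "Linfty_on S f \<longleftrightarrow>
     f \<in> borel_measurable (lebesgue_on S) \<and> (\<exists>M. AE x in lebesgue_on S. norm (f x) \<le> M)"

definition Avg :: "('a::euclidean_space \<Rightarrow> complex) \<Rightarrow> 'a set \<Rightarrow> complex" where
  "Avg f S = (LINT x:S|lebesgue. f x) / of_real (measure lebesgue S)"

text \<open>
  Surface measure of the unit sphere, by the cone construction
  \<open>\<sigma> A = d \<cdot> vol {r *\<^sub>R y | 0 < r < 1, y \<in> A}\<close>: the set on the right is the
  preimage of \<open>A\<close> under \<open>sgn x = x /\<^sub>R norm x\<close> in the punctured unit ball.
\<close>

definition sphere_measure :: "'a::euclidean_space measure" where
  "sphere_measure =
     scale_measure (of_nat DIM('a))
       (distr (restrict_space lborel (ball 0 1 - {0})) (restrict_space borel (sphere 0 1)) sgn)"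

lemma space_sphere_measure: "space (sphere_measure :: 'a::euclidean_space measure) = sphere 0 1"
  by (simp add: sphere_measure_def space_scale_measure space_restrict_space)

lemma emeasure_sphere_measure:
  fixes A :: "'a::euclidean_space set"
  assumes "A \<in> sets borel" and "A \<subseteq> sphere 0 1"
  shows "emeasure sphere_measure A =
    of_nat DIM('a) * emeasure lborel {x \<in> ball 0 1 - {0}. sgn x \<in> A}"
proof -
  have b: "(ball 0 1 - {0} :: 'a set) \<in> sets borel"
    by auto
  have sb: "(sgn :: 'a \<Rightarrow> 'a) \<in> borel_measurable borel"
    unfolding sgn_div_norm by measurable
  have s: "(sgn :: 'a \<Rightarrow> 'a) \<in> measurable (restrict_space lborel (ball 0 1 - {0}))
             (restrict_space borel (sphere 0 1))"
    using sb by (intro measurable_restrict_space3) (auto simp: norm_sgn)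
  have e: "sgn -` A \<inter> (ball 0 1 - {0}) = {x \<in> ball 0 1 - {0}. sgn x \<in> A}"
    by auto
  have A: "A \<in> sets (restrict_space borel (sphere 0 1))"
    using assms by (auto simp: sets_restrict_space_iff)
  show ?thesis
    unfolding sphere_measure_def emeasure_scale_measure emeasure_distr[OF s A]
    using b by (subst emeasure_restrict_space) (simp_all only: space_restrict_space space_lborel space_borel UNIV_I Int_UNIV_right e, auto)
qed

lemma emeasure_sphere_measure_sphere:
  "emeasure (sphere_measure :: 'a::euclidean_space measure) (sphere 0 1) =
     ennreal (DIM('a) * unit_ball_vol DIM('a))"
proof -
  have "{x \<in> ball 0 1 - {0}. sgn x \<in> sphere 0 1} = ball (0::'a) 1 - {0}"
    by (auto simp: norm_sgn)
  moreover have "emeasure lborel (ball (0::'a) 1 - {0}) = emeasure lborel (ball (0::'a) 1)"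
    by (subst emeasure_Diff) auto
  ultimately show ?thesis
    by (simp add: emeasure_sphere_measure emeasure_ball ennreal_mult ennreal_of_nat_eq_real_of_nat)
qed

text \<open>
  Replacing \<open>\<integral>\<^sub>D \<rho> u\<close> by \<open>\<epsilon>\<^sup>d (\<Sum>j. Avg \<rho> D\<^sub>j \<cdot> vol B\<^sub>j \<cdot> u (x j))\<close>, for \<open>u\<close> a plane wave, in the
  direct sampling functional \<open>W\<close> gives its leading-order term as \<open>\<epsilon> \<rightarrow> 0\<close>.
\<close>

definition W\<^sub>0 :: "real \<Rightarrow> real \<Rightarrow> nat \<Rightarrow> (nat \<Rightarrow> 'a) \<Rightarrow> (nat \<Rightarrow> 'a set) \<Rightarrow> ('a \<Rightarrow> complex)
    \<Rightarrow> 'a::euclidean_space \<Rightarrow> real" where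
  "W\<^sub>0 k \<epsilon> J x B \<rho> z = norm (of_real (\<epsilon> ^ DIM('a)) *
     (\<Sum>j=1..J. Avg \<rho> (region \<epsilon> (x j) (B j)) * of_real (measure lebesgue (B j)) *
        (LINT y|sphere_measure. exp (\<i> * of_real (k * ((x j - z) \<bullet> y))))))"

end

theory Submission
  imports Defs
begin

text \<open>
  Each source point contributes to \<open>W\<^sub>0\<close> the Fourier transform of surface measure on the unit sphere,
  evaluated at \<open>w = k (x\<^sub>j - z)\<close>; since \<open>\<bar>w\<bar>\<close> is at least \<open>k\<close> times the distance of \<open>z\<close> from the
  source points, it suffices that this Fourier transform is \<open>O(\<bar>w\<bar> powr ((1 - d) / 2))\<close>. Explicitly it is
  \<open>2\<pi> J\<^sub>0(\<bar>w\<bar>)\<close> for \<open>d = 2\<close> and \<open>4\<pi> sin \<bar>w\<bar> / \<bar>w\<bar>\<close> for \<open>d = 3\<close>, but the decay is obtained below for both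
  dimensions at once, with neither stationary phase nor polar coordinates.

  Surface measure is invariant under orthogonal maps, because Lebesgue measure is
  (\<open>emeasure_lborel_orthogonal_vimage\<close>, \<open>integral_sphere_orthogonal\<close>). Hence the transform is real and
  radial, equal to \<open>\<Phi>(\<bar>w\<bar>)\<close> with \<open>\<Phi>(t) = \<integral> cos (t y\<^sub>i)\<close>, the function \<open>sphere_cos i\<close>.
  Invariance under the infinitesimal rotations of the planes spanned by axis \<open>i\<close> and another axis is
  integration by parts on the sphere (\<open>integral_sphere_infinitesimal_rotation\<close>). Summed over these
  planes it gives the Bessel equation \<open>t (\<Phi>'' + \<Phi>) + (d - 1) \<Phi>' = 0\<close>.

  With \<open>n = d - 1\<close>, the function \<open>u = t powr (n / 2) * \<Phi>\<close> then satisfies \<open>u'' + q u = 0\<close> with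
  \<open>q = 1 + n (2 - n) / (4 t\<^sup>2)\<close>. For \<open>0 \<le> n \<le> 2\<close> the coefficient \<open>q\<close> is at least \<open>1\<close> and nonincreasing, so the
  energy \<open>u'\<^sup>2 + q u\<^sup>2\<close> is nonincreasing and \<open>u\<close> stays bounded (\<open>bessel_type_ode_decay\<close>).
\<close>

section \<open>Orthogonal invariance of Lebesgue measure\<close>

lemma nn_integral_lborel_translate:
  fixes f :: "'a::euclidean_space \<Rightarrow> ennreal"
  assumes [measurable]: "f \<in> borel_measurable borel"
  shows "(\<integral>\<^sup>+x. f (c + x) \<partial>lborel) = (\<integral>\<^sup>+x. f x \<partial>lborel)"
proof -
  have "(\<integral>\<^sup>+x. f x \<partial>lborel) = (\<integral>\<^sup>+x. f x \<partial>distr lborel borel ((+) c))"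
    by (simp add: lborel_distr_plus)
  also have "\<dots> = (\<integral>\<^sup>+x. f (c + x) \<partial>lborel)"
    by (subst nn_integral_distr) simp_all
  finally show ?thesis ..
qed

lemma orthogonal_transformation_measurable:
  fixes R :: "'a::euclidean_space \<Rightarrow> 'a"
  assumes "orthogonal_transformation R"
  shows "R \<in> borel_measurable borel"
  using assms
  by (intro borel_measurable_continuous_onI linear_continuous_on)
     (simp add: orthogonal_transformation_linear linear_conv_bounded_linear[symmetric])

text \<open>
  This is uniqueness of translation-invariant measures, carried out for the image of Lebesgue measure
  \<open>\<lambda>\<close> under \<open>R\<close>. With \<open>Q\<close> the unit ball, the measure of the pairs \<open>(x, y)\<close> with \<open>y \<in> Q\<close> and
  \<open>R x + y \<in> A\<close> is computed by Fubini in both orders. Translating \<open>x\<close> by \<open>inv R y\<close> yields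
  \<open>\<lambda> (R -` A) * \<lambda> Q\<close>; translating \<open>y\<close> by \<open>R x\<close> yields \<open>\<lambda> A * \<lambda> Q\<close>, as the preimage under \<open>R\<close>
  of a unit ball is a unit ball.
\<close>

lemma emeasure_lborel_orthogonal_vimage:
  fixes R :: "'a::euclidean_space \<Rightarrow> 'a"
  assumes R: "orthogonal_transformation R" and [measurable]: "A \<in> sets borel"
  shows "emeasure lborel (R -` A) = emeasure lborel A"
proof -
  define b where "b = emeasure lborel (ball (0::'a) 1)"
  define g :: "'a \<Rightarrow> ennreal" where "g = indicator (ball 0 1)"
  have [measurable]: "g \<in> borel_measurable borel"
    unfolding g_def by (intro borel_measurable_indicator) simp
  have g: "(\<integral>\<^sup>+y. g y \<partial>lborel) = b"
    by (simp add: g_def b_def)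
  have [measurable]: "R \<in> borel_measurable borel"
    using R by (rule orthogonal_transformation_measurable)
  have linR: "R (u + v) = R u + R v" for u v
    using R by (simp add: orthogonal_transformation_linear linear_add)
  have "surj R"
    using R by (rule orthogonal_transformation_surj)
  then have RR: "R (inv R y) = y" for y
    by (rule surj_f_inv_f)
  let ?f = "\<lambda>x y. indicator A (R x + y) * g y"
  have "(\<integral>\<^sup>+y. \<integral>\<^sup>+x. ?f x y \<partial>lborel \<partial>lborel) = emeasure lborel (R -` A) * b"
  proof -
    have "(\<integral>\<^sup>+x. ?f x y \<partial>lborel) = emeasure lborel (R -` A) * g y" for y
    proof -
      have "R x + y = R (inv R y + x)" for x
        by (simp add: linR RR)
      then have "(\<integral>\<^sup>+x. ?f x y \<partial>lborel) =
          (\<integral>\<^sup>+x. indicator A (R (inv R y + x)) * g y \<partial>lborel)"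
        by presburger
      also have "\<dots> = (\<integral>\<^sup>+x. indicator A (R (inv R y + x)) \<partial>lborel) * g y"
        by (rule nn_integral_multc) measurable
      also have "(\<integral>\<^sup>+x. indicator A (R (inv R y + x)) \<partial>lborel) =
          (\<integral>\<^sup>+x. indicator A (R x) \<partial>lborel)"
        by (rule nn_integral_lborel_translate) measurable
      also have "\<dots> = (\<integral>\<^sup>+x. indicator (R -` A) x \<partial>lborel)"
        by (simp add: indicator_def)
      also have "\<dots> = emeasure lborel (R -` A)"
        using measurable_sets[of R borel borel A] by (intro nn_integral_indicator) simp
      finally show ?thesis .
    qed
    then show ?thesis
      by (simp add: nn_integral_cmult g)
  qed
  moreover have "(\<integral>\<^sup>+x. \<integral>\<^sup>+y. ?f x y \<partial>lborel \<partial>lborel) = emeasure lborel A * b"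
  proof -
    have "(\<integral>\<^sup>+y. ?f x y \<partial>lborel) = (\<integral>\<^sup>+y. indicator A y * g (y - R x) \<partial>lborel)"
      for x
    proof -
      have "(\<lambda>y. indicator A y * g (y - R x) :: ennreal) \<in> borel_measurable borel"
        by measurable
      from nn_integral_lborel_translate[OF this, of "R x"] show ?thesis
        by simp
    qed
    moreover have "(\<integral>\<^sup>+x. \<integral>\<^sup>+y. indicator A y * g (y - R x) \<partial>lborel \<partial>lborel) =
        (\<integral>\<^sup>+y. \<integral>\<^sup>+x. indicator A y * g (y - R x) \<partial>lborel \<partial>lborel)"
      by (rule lborel_pair.Fubini') measurable
    moreover have "(\<integral>\<^sup>+x. indicator A y * g (y - R x) \<partial>lborel) = indicator A y * b"
      for y
    proof -
      have "y - R x = R (inv R y - x)" for x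
        using R by (simp add: orthogonal_transformation_linear linear_diff RR)
      then have "dist 0 (y - R x) = dist (inv R y) x" for x
        using R by (simp add: orthogonal_transformation dist_norm)
      then have "(\<lambda>x. g (y - R x)) = indicator (ball (inv R y) 1)"
        by (simp add: g_def indicator_def fun_eq_iff del: dist_0_norm)
      then show ?thesis
        by (subst nn_integral_cmult)
           (auto simp: b_def emeasure_ball intro!: borel_measurable_indicator)
    qed
    ultimately show ?thesis
      by (simp add: nn_integral_multc)
  qed
  moreover have "(\<integral>\<^sup>+y. \<integral>\<^sup>+x. ?f x y \<partial>lborel \<partial>lborel) = (\<integral>\<^sup>+x. \<integral>\<^sup>+y. ?f x y \<partial>lborel \<partial>lborel)"
    by (rule lborel_pair.Fubini') measurable
  ultimately have "emeasure lborel (R -` A) * b = emeasure lborel A * b"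
    by simp
  moreover have "unit_ball_vol (real DIM('a)) \<noteq> 0"
    using unit_ball_vol_pos[of "real DIM('a)"] by linarith
  then have "b \<noteq> 0" "b \<noteq> \<infinity>"
    by (simp_all add: b_def emeasure_ball)
  ultimately show ?thesis
    by (metis mult_divide_eq_ennreal infinity_ennreal_def)
qed

section \<open>Orthogonal invariance of surface measure\<close>

lemma measurable_sphere_measureI:
  fixes f :: "'a::euclidean_space \<Rightarrow> 'b::topological_space"
  assumes "f \<in> borel_measurable borel"
  shows "f \<in> borel_measurable sphere_measure"
proof -
  have "sets (sphere_measure :: 'a measure) = sets (restrict_space borel (sphere 0 1))"
    by (simp add: sphere_measure_def)
  then show ?thesis
    using measurable_restrict_space1[OF assms] measurable_cong_sets by blast
qed

lemma finite_measure_sphere_measure: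
  "finite_measure (sphere_measure :: 'a::euclidean_space measure)"
  by (rule finite_measureI) (simp add: space_sphere_measure emeasure_sphere_measure_sphere)

text \<open>
  \<open>R\<close> commutes with \<open>sgn\<close> and preserves the punctured unit ball, so the cone over \<open>R -` A\<close> is the
  preimage under \<open>R\<close> of the cone over \<open>A\<close>, and the two cones have the same volume.
\<close>

lemma distr_sphere_measure_orthogonal:
  fixes R :: "'a::euclidean_space \<Rightarrow> 'a"
  assumes R: "orthogonal_transformation R"
  shows "distr sphere_measure sphere_measure R = sphere_measure"
proof (rule measure_eqI)
  have S: "sets (sphere_measure :: 'a measure) = sets (restrict_space borel (sphere 0 1))"
    by (simp add: sphere_measure_def)
  have mR: "R \<in> borel_measurable borel"
    using R by (rule orthogonal_transformation_measurable)
  have nR: "norm (R y) = norm y" for y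
    using R by (simp add: orthogonal_transformation)
  have mRS: "R \<in> measurable sphere_measure sphere_measure"
    unfolding measurable_cong_sets[OF S S]
    using mR by (intro measurable_restrict_space3) (auto simp: nR)
  fix A :: "'a set"
  assume "A \<in> sets (distr sphere_measure sphere_measure R)"
  then have A: "A \<in> sets sphere_measure" "A \<in> sets borel" "A \<subseteq> sphere 0 1"
    unfolding S by (auto simp: sets_restrict_space_iff S)
  have bR: "R -` A \<in> sets borel"
    using measurable_sets[OF mR A(2)] by simp
  have R_sgn: "R (sgn y) = sgn (R y)" for y
    using R by (simp add: sgn_div_norm nR orthogonal_transformation_linear linear_scale)
  let ?C = "{y \<in> ball 0 1 - {0}. sgn y \<in> A}"
  have [measurable]: "(sgn :: 'a \<Rightarrow> 'a) \<in> borel_measurable borel"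
    unfolding sgn_div_norm by measurable
  note [measurable] = A(2)
  have C: "?C \<in> sets borel"
    by measurable
  have "emeasure (distr sphere_measure sphere_measure R) A = emeasure sphere_measure (R -` A)"
    using A(3) by (subst emeasure_distr[OF mRS A(1)])
      (auto simp: space_sphere_measure nR intro!: arg_cong[where f = "emeasure sphere_measure"])
  also have "\<dots> = of_nat DIM('a) * emeasure lborel {y \<in> ball 0 1 - {0}. sgn y \<in> R -` A}"
    using A(3) by (intro emeasure_sphere_measure bR) (auto simp: nR)
  also have "{y \<in> ball 0 1 - {0}. sgn y \<in> R -` A} = R -` ?C"
    by (auto simp: R_sgn nR) (metis norm_eq_zero nR)+
  also have "emeasure lborel (R -` ?C) = emeasure lborel ?C"
    using R C by (rule emeasure_lborel_orthogonal_vimage)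
  also have "of_nat DIM('a) * emeasure lborel ?C = emeasure sphere_measure A"
    using A by (simp add: emeasure_sphere_measure)
  finally show "emeasure (distr sphere_measure sphere_measure R) A = emeasure sphere_measure A" .
qed simp

lemma integral_sphere_orthogonal:
  fixes R :: "'a::euclidean_space \<Rightarrow> 'a" and f :: "'a \<Rightarrow> 'b::{banach, second_countable_topology}"
  assumes R: "orthogonal_transformation R" and f: "f \<in> borel_measurable borel"
  shows "(LINT y|sphere_measure. f (R y)) = (LINT y|sphere_measure. f y)"
proof -
  have S: "sets (sphere_measure :: 'a measure) = sets (restrict_space borel (sphere 0 1))"
    by (simp add: sphere_measure_def)
  have "R \<in> measurable sphere_measure sphere_measure"
    unfolding measurable_cong_sets[OF S S]
    using R orthogonal_transformation_measurable[OF R]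
    by (intro measurable_restrict_space3) (auto simp: orthogonal_transformation)
  then have "(LINT y|distr sphere_measure sphere_measure R. f y) = (LINT y|sphere_measure. f (R y))"
    using f by (intro integral_distr measurable_sphere_measureI)
  then show ?thesis
    using R by (simp add: distr_sphere_measure_orthogonal)
qed

section \<open>Differentiation under the integral sign\<close>

text \<open>
  The difference quotients are bounded by \<open>C\<close> by the mean value theorem, and constants are integrable
  for a finite measure, so dominated convergence applies.
\<close>

lemma has_real_derivative_integral:
  fixes f f' :: "real \<Rightarrow> 'a \<Rightarrow> real"
  assumes "finite_measure M"
    and f[measurable]: "\<And>t. f t \<in> borel_measurable M"
    and f'[measurable]: "\<And>t. f' t \<in> borel_measurable M"
    and int: "\<And>t. integrable M (f t)"
    and der: "\<And>t y. y \<in> space M \<Longrightarrow> ((\<lambda>t. f t y) has_real_derivative f' t y) (at t)"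
    and bound: "\<And>t y. y \<in> space M \<Longrightarrow> \<bar>f' t y\<bar> \<le> C"
  shows "((\<lambda>t. LINT y|M. f t y) has_real_derivative (LINT y|M. f' t y)) (at t)"
  unfolding has_field_derivative_iff tendsto_at_iff_sequentially comp_def
proof (intro allI impI)
  interpret finite_measure M by fact
  fix X assume X: "\<forall>n. X n \<in> UNIV - {t}" "X \<longlonglongrightarrow> t"
  have "(\<lambda>n. LINT y|M. (f (X n) y - f t y) / (X n - t)) \<longlonglongrightarrow> (LINT y|M. f' t y)"
  proof (rule integral_dominated_convergence[where w = "\<lambda>_. C"])
    show "AE y in M. (\<lambda>n. (f (X n) y - f t y) / (X n - t)) \<longlonglongrightarrow> f' t y"
    proof (rule AE_I2)
      fix y assume "y \<in> space M"
      then have "((\<lambda>s. (f s y - f t y) / (s - t)) \<longlongrightarrow> f' t y) (at t)"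
        using der by (simp add: has_field_derivative_iff)
      then show "(\<lambda>n. (f (X n) y - f t y) / (X n - t)) \<longlonglongrightarrow> f' t y"
        using X by (auto simp: tendsto_at_iff_sequentially comp_def)
    qed
    show "AE y in M. norm ((f (X n) y - f t y) / (X n - t)) \<le> C" for n
    proof (rule AE_I2)
      fix y assume y: "y \<in> space M"
      have "norm (f (X n) y - f t y) \<le> C * norm (X n - t)"
        by (rule field_differentiable_bound[where S = UNIV and f' = "\<lambda>t. f' t y"])
           (use der bound y in auto)
      then show "norm ((f (X n) y - f t y) / (X n - t)) \<le> C"
        using X(1) by (simp add: divide_le_eq)
    qed
  qed simp_all
  then show "(\<lambda>n. ((LINT y|M. f (X n) y) - (LINT y|M. f t y)) / (X n - t))
      \<longlonglongrightarrow> (LINT y|M. f' t y)"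
    by (simp add: int)
qed

section \<open>Decay for Bessel-type equations\<close>

text \<open>
  With \<open>u = t powr (n / 2) * \<Phi>\<close>, the function \<open>E\<close> in the proof is the energy \<open>u'\<^sup>2 + q u\<^sup>2\<close> of
  \<open>u'' + q u = 0\<close>, where \<open>q = 1 + n (2 - n) / (4 t\<^sup>2)\<close>. Its derivative is \<open>q' u\<^sup>2\<close>, and \<open>0 \<le> n \<le> 2\<close> makes
  both \<open>q \<ge> 1\<close> and \<open>q' \<le> 0\<close>; hence \<open>u\<^sup>2 \<le> E(t) \<le> E(1)\<close> for \<open>t \<ge> 1\<close>.
\<close>

lemma bessel_type_ode_decay:
  fixes \<Phi> \<Phi>' \<Phi>'' :: "real \<Rightarrow> real" and n :: real
  assumes "0 \<le> n" "n \<le> 2"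
    and der: "\<And>t. (\<Phi> has_real_derivative \<Phi>' t) (at t)"
      "\<And>t. (\<Phi>' has_real_derivative \<Phi>'' t) (at t)"
    and ode: "\<And>t. t * (\<Phi>'' t + \<Phi> t) + n * \<Phi>' t = 0"
  obtains K where "\<And>t. t \<ge> 1 \<Longrightarrow> \<bar>\<Phi> t\<bar> \<le> K * t powr (- n / 2)"
proof -
  \<comment> \<open>\<open>u' = t powr (n / 2) * (\<Phi>' + n \<Phi> / (2 t))\<close>, and \<open>H\<close> is the energy without its factor \<open>t powr n\<close>.\<close>
  define H where "H = (\<lambda>t. (\<Phi>' t + n / 2 * \<Phi> t / t)\<^sup>2 + (1 + n * (2 - n) / 4 / t\<^sup>2) * (\<Phi> t)\<^sup>2)"
  define E where "E = (\<lambda>t. t powr n * H t)"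
  have derE: "\<exists>D. (E has_real_derivative D) (at t) \<and> D \<le> 0" if "t > 0" for t
  proof -
    have \<Phi>'': "\<Phi>'' t = - \<Phi> t - n * \<Phi>' t / t"
      using ode[of t] that by (simp add: field_simps)
    define H' where "H' = 2 * (\<Phi>' t + n / 2 * \<Phi> t / t) *
        (\<Phi>'' t + (n / 2 * \<Phi>' t * t - n / 2 * \<Phi> t) / t\<^sup>2)
        - n * (2 - n) / 2 / t ^ 3 * (\<Phi> t)\<^sup>2 + (1 + n * (2 - n) / 4 / t\<^sup>2) * (2 * \<Phi> t * \<Phi>' t)"
    have "(H has_real_derivative H') (at t)"
      unfolding H_def H'_def using that
      by (auto intro!: derivative_eq_intros der simp: power2_eq_square power3_eq_cube field_simps)
    then have "(E has_real_derivative t powr n * (n / t * H t + H')) (at t)"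
      unfolding E_def using that
      by (auto intro!: derivative_eq_intros simp: powr_diff field_simps)
    moreover have "n / t * H t + H' = - (n * (2 - n) / 2 / t ^ 3 * (\<Phi> t)\<^sup>2)"
      unfolding H_def H'_def \<Phi>'' using that
      by (simp add: power2_eq_square power3_eq_cube divide_simps) algebra
    moreover have "0 \<le> n * (2 - n) / 2 / t ^ 3 * (\<Phi> t)\<^sup>2"
      using that assms(1,2) by simp
    ultimately show ?thesis
      by (metis mult_nonneg_nonpos neg_le_0_iff_le powr_ge_zero)
  qed
  have "\<bar>\<Phi> t\<bar> \<le> sqrt (E 1) * t powr (- n / 2)" if "t \<ge> 1" for t
  proof -
    have "0 \<le> n * (2 - n) / 4 / t\<^sup>2"
      using assms(1,2) by simp
    then have "1 * (\<Phi> t)\<^sup>2 \<le> (1 + n * (2 - n) / 4 / t\<^sup>2) * (\<Phi> t)\<^sup>2"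
      by (intro mult_right_mono) simp_all
    then have "(\<Phi> t)\<^sup>2 \<le> H t"
      unfolding H_def by (smt (verit) zero_le_power2)
    then have "t powr n * (\<Phi> t)\<^sup>2 \<le> E t"
      unfolding E_def by (intro mult_left_mono) simp_all
    also have "E t \<le> E 1"
      using that derE by (intro DERIV_nonpos_imp_nonincreasing[OF that]) auto
    finally have "(\<Phi> t)\<^sup>2 \<le> E 1 * t powr (- n)"
      using that by (simp add: powr_minus field_simps)
    then have "sqrt ((\<Phi> t)\<^sup>2) \<le> sqrt (E 1 * t powr (- n))"
      by (rule real_sqrt_le_mono)
    also have "\<dots> = sqrt (E 1) * t powr (- n / 2)"
      using powr_half_sqrt_powr[of t "- n"] that by (simp add: real_sqrt_mult)
    finally show ?thesis
      by simp
  qed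
  then show ?thesis
    by (rule that)
qed


section \<open>The Fourier transform of surface measure\<close>

lemma abs_component_le_1_on_sphere:
  fixes y :: "real ^ 'n"
  assumes "y \<in> space sphere_measure"
  shows "\<bar>y $ i\<bar> \<le> 1"
  using assms component_le_norm_cart[of y i] by (simp add: space_sphere_measure)

lemma sum_components_squared_on_sphere:
  fixes y :: "real ^ 'n"
  assumes "y \<in> space sphere_measure"
  shows "(\<Sum>k\<in>UNIV. (y $ k)\<^sup>2) = 1"
  using assms by (simp add: space_sphere_measure norm_eq_1 inner_vec_def power2_eq_square)

lemma integrable_sphere_bounded:
  fixes f :: "'a::euclidean_space \<Rightarrow> 'b::{banach, second_countable_topology}"
  assumes "f \<in> borel_measurable borel"
    and "\<And>y. y \<in> space sphere_measure \<Longrightarrow> norm (f y) \<le> C"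
  shows "integrable sphere_measure f"
  using assms
  by (intro finite_measure.integrable_const_bound[OF finite_measure_sphere_measure, of _ C])
     (auto intro: measurable_sphere_measureI)

text \<open>
  Writing the rotation as a correction of \<open>y\<close> along the two axes, rather than by cases on coordinates,
  lets linearity and inner products be computed from inner products of axes alone.
\<close>

definition plane_rotation :: "'n::finite \<Rightarrow> 'n \<Rightarrow> real \<Rightarrow> real ^ 'n \<Rightarrow> real ^ 'n" where
  "plane_rotation i j \<theta> y = y + ((cos \<theta> - 1) * y $ i - sin \<theta> * y $ j) *\<^sub>R axis i 1
     + (sin \<theta> * y $ i + (cos \<theta> - 1) * y $ j) *\<^sub>R axis j 1"

lemma plane_rotation_nth:
  assumes "i \<noteq> j"
  shows "plane_rotation i j \<theta> y $ i = cos \<theta> * y $ i - sin \<theta> * y $ j"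
    and "plane_rotation i j \<theta> y $ j = sin \<theta> * y $ i + cos \<theta> * y $ j"
  using assms by (simp_all add: plane_rotation_def axis_def algebra_simps)

lemma orthogonal_transformation_plane_rotation:
  fixes i j :: "'n::finite"
  assumes "i \<noteq> j"
  shows "orthogonal_transformation (plane_rotation i j \<theta>)"
  unfolding orthogonal_transformation_def
proof (intro conjI allI)
  show "linear (plane_rotation i j \<theta>)"
    by (rule linearI) (simp_all add: plane_rotation_def algebra_simps)
  fix v w :: "real ^ 'n"
  define c s where "c = cos \<theta>" and "s = sin \<theta>"
  have "(axis i 1 :: real ^ 'n) $ j = 0" "(axis j 1 :: real ^ 'n) $ i = 0"
    using assms by (simp_all add: axis_def)
  then have "plane_rotation i j \<theta> v \<bullet> plane_rotation i j \<theta> w = v \<bullet> w +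
      ((c\<^sup>2 + s\<^sup>2) - 1) * (v $ i * w $ i + v $ j * w $ j)"
    using assms unfolding plane_rotation_def c_def[symmetric] s_def[symmetric]
    by (simp add: inner_add_left inner_add_right inner_axis inner_axis' inner_axis_axis)
       (simp add: algebra_simps power2_eq_square)
  then show "plane_rotation i j \<theta> v \<bullet> plane_rotation i j \<theta> w = v \<bullet> w"
    by (simp add: c_def s_def)
qed

lemma abs_mult_bounded_1_le_1:
  fixes a b :: real
  assumes "\<bar>a\<bar> \<le> 1" "\<bar>b\<bar> \<le> 1"
  shows "\<bar>a * b\<bar> \<le> 1"
  using assms mult_mono[of "\<bar>a\<bar>" 1 "\<bar>b\<bar>" 1] by (simp add: abs_mult)

text \<open>
  By invariance, \<open>\<integral> f (R\<^sub>\<theta> y)\<close> does not depend on the angle \<open>\<theta>\<close> when \<open>R\<^sub>\<theta>\<close> is the rotation of the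
  \<open>(i, j)\<close>-plane. For \<open>f y = y\<^sub>j sin (t y\<^sub>i)\<close> its derivative at \<open>\<theta> = 0\<close> is the integral below.
\<close>

lemma integral_sphere_infinitesimal_rotation:
  fixes i j :: "'n::finite"
  assumes ij: "i \<noteq> j"
  shows "(LINT y::real ^ 'n|sphere_measure.
    y $ i * sin (t * y $ i) - t * ((y $ j)\<^sup>2 * cos (t * y $ i))) = 0"
proof -
  let ?M = "sphere_measure :: (real ^ 'n) measure"
  define a b where "a = (\<lambda>\<theta> y. plane_rotation i j \<theta> y $ i)"
    and "b = (\<lambda>\<theta> y. plane_rotation i j \<theta> y $ j)"
  have ab: "a = (\<lambda>\<theta> y. cos \<theta> * y $ i - sin \<theta> * y $ j)"
    "b = (\<lambda>\<theta> y. sin \<theta> * y $ i + cos \<theta> * y $ j)"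
    by (simp_all add: a_def b_def plane_rotation_nth[OF ij])
  have R: "orthogonal_transformation (plane_rotation i j \<theta>)" for \<theta>
    using ij by (rule orthogonal_transformation_plane_rotation)
  have le1: "\<bar>a \<theta> y\<bar> \<le> 1" "\<bar>b \<theta> y\<bar> \<le> 1" if "y \<in> space ?M" for \<theta> y
  proof -
    have "plane_rotation i j \<theta> y \<in> space ?M"
      using that R[of \<theta>] by (simp add: space_sphere_measure orthogonal_transformation)
    then show "\<bar>a \<theta> y\<bar> \<le> 1" "\<bar>b \<theta> y\<bar> \<le> 1"
      by (simp_all add: a_def b_def abs_component_le_1_on_sphere)
  qed
  define f f' where "f = (\<lambda>\<theta> y. b \<theta> y * sin (t * a \<theta> y))"
    and "f' = (\<lambda>\<theta> y. a \<theta> y * sin (t * a \<theta> y) - t * (b \<theta> y * (b \<theta> y * cos (t * a \<theta> y))))"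
  have mf: "f \<theta> \<in> borel_measurable borel" "f' \<theta> \<in> borel_measurable borel" for \<theta>
    unfolding f_def f'_def ab
    by (intro borel_measurable_continuous_onI continuous_intros)+
  have "((\<lambda>\<theta>. LINT y|?M. f \<theta> y) has_real_derivative (LINT y|?M. f' 0 y)) (at 0)"
  proof (rule has_real_derivative_integral[where C = "1 + \<bar>t\<bar>"])
    fix \<theta> :: real and y assume y: "y \<in> space ?M"
    show "((\<lambda>\<theta>. f \<theta> y) has_real_derivative f' \<theta> y) (at \<theta>)"
      unfolding f_def f'_def ab
      by (auto intro!: derivative_eq_intros simp: algebra_simps)
    have "\<bar>a \<theta> y * sin (t * a \<theta> y)\<bar> \<le> 1" "\<bar>b \<theta> y * (b \<theta> y * cos (t * a \<theta> y))\<bar> \<le> 1"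
      by (intro abs_mult_bounded_1_le_1 le1 y abs_sin_le_one abs_cos_le_one)+
    then show "\<bar>f' \<theta> y\<bar> \<le> 1 + \<bar>t\<bar>"
      unfolding f'_def
      by (intro order_trans[OF abs_triangle_ineq4] add_mono)
         (simp_all add: abs_mult mult_left_le)
  next
    fix \<theta> :: real
    show "integrable ?M (f \<theta>)"
      unfolding f_def
      by (rule integrable_sphere_bounded[OF mf(1)[unfolded f_def], where C = 1])
         (simp only: real_norm_def abs_mult_bounded_1_le_1 le1 abs_sin_le_one)
  qed (use mf in \<open>auto intro: measurable_sphere_measureI finite_measure_sphere_measure\<close>)
  moreover have "(LINT y|?M. f \<theta> y) = (LINT y|?M. y $ j * sin (t * y $ i))" for \<theta>
    unfolding f_def a_def b_def
    by (rule integral_sphere_orthogonal[OF R])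
       (intro borel_measurable_continuous_onI continuous_intros)
  ultimately have "(LINT y|?M. f' 0 y) = 0"
    using DERIV_unique[OF DERIV_const] by simp
  then show ?thesis
    by (simp add: f'_def ab power2_eq_square mult.assoc)
qed

definition sphere_cos :: "'n::finite \<Rightarrow> real \<Rightarrow> real" where
  "sphere_cos i t = (LINT y::real ^ 'n|sphere_measure. cos (t * y $ i))"

text \<open>
  Let \<open>S = \<integral> y\<^sub>i sin (t y\<^sub>i)\<close> and \<open>C\<^sub>j = \<integral> y\<^sub>j\<^sup>2 cos (t y\<^sub>i)\<close>, so that \<open>\<Phi>' = - S\<close> and
  \<open>\<Phi>'' = - C\<^sub>i\<close>. Infinitesimal rotations give \<open>S = t C\<^sub>j\<close> for every \<open>j \<noteq> i\<close>, while
  \<open>\<Sum>j. C\<^sub>j = \<Phi>\<close> because the squared coordinates add up to \<open>1\<close>. Adding the relations gives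
  \<open>(d - 1) S = t (\<Phi> - C\<^sub>i)\<close>, which is Bessel's equation for \<open>\<Phi>\<close>.
\<close>

lemma sphere_cos_decay:
  fixes i :: "'n::finite"
  assumes n: "CARD('n) \<le> 3"
  obtains K where "\<And>t. t \<ge> 1 \<Longrightarrow> \<bar>sphere_cos i t\<bar> \<le> K * t powr ((1 - real CARD('n)) / 2)"
proof -
  let ?M = "sphere_measure :: (real ^ 'n) measure"
  define \<Phi>' \<Phi>'' where "\<Phi>' = (\<lambda>t. LINT y|?M. - (y $ i * sin (t * y $ i)))"
    and "\<Phi>'' = (\<lambda>t. LINT y|?M. - ((y $ i)\<^sup>2 * cos (t * y $ i)))"
  have m: "(\<lambda>y. cos (t * y $ i)) \<in> borel_measurable (borel :: (real ^ 'n) measure)"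
    "(\<lambda>y. y $ j * sin (t * y $ i)) \<in> borel_measurable (borel :: (real ^ 'n) measure)"
    "(\<lambda>y. (y $ j)\<^sup>2 * cos (t * y $ i)) \<in> borel_measurable (borel :: (real ^ 'n) measure)" for t j
    by (intro borel_measurable_continuous_onI continuous_intros)+
  have le: "\<bar>y $ j * sin (t * y $ i)\<bar> \<le> 1" "\<bar>(y $ j)\<^sup>2 * cos (t * y $ i)\<bar> \<le> 1"
    if "y \<in> space ?M" for t j and y :: "real ^ 'n"
    unfolding power2_eq_square
    by (intro abs_mult_bounded_1_le_1 abs_component_le_1_on_sphere that
        abs_sin_le_one abs_cos_le_one)+
  have int: "integrable ?M (\<lambda>y. cos (t * y $ i))"
    "integrable ?M (\<lambda>y. y $ j * sin (t * y $ i))"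
    "integrable ?M (\<lambda>y. (y $ j)\<^sup>2 * cos (t * y $ i))" for t j
    by (rule integrable_sphere_bounded[where C = 1]; use m le in simp)+
  have d1: "(sphere_cos i has_real_derivative \<Phi>' t) (at t)" for t
    unfolding sphere_cos_def \<Phi>'_def
    by (rule has_real_derivative_integral[where C = 1])
       (use m le int in \<open>auto intro: measurable_sphere_measureI finite_measure_sphere_measure
         intro!: derivative_eq_intros\<close>)
  have d2: "(\<Phi>' has_real_derivative \<Phi>'' t) (at t)" for t
    unfolding \<Phi>'_def \<Phi>''_def
    by (rule has_real_derivative_integral[where C = 1])
       (use m le int in \<open>auto intro: measurable_sphere_measureI finite_measure_sphere_measure
         intro!: derivative_eq_intros simp: power2_eq_square\<close>)
  have ode: "t * (\<Phi>'' t + sphere_cos i t) + (real CARD('n) - 1) * \<Phi>' t = 0" for t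
  proof -
    define S where "S = (LINT y|?M. y $ i * sin (t * y $ i))"
    define C where "C j = (LINT y|?M. (y $ j)\<^sup>2 * cos (t * y $ i))" for j
    have "S = t * C j" if "j \<noteq> i" for j
      using integral_sphere_infinitesimal_rotation[of i j t] that int
      by (simp add: S_def C_def)
    then have "(\<Sum>j\<in>UNIV - {i}. S) = (\<Sum>j\<in>UNIV - {i}. t * C j)"
      by (intro sum.cong) auto
    then have "(real CARD('n) - 1) * S = t * (\<Sum>j\<in>UNIV - {i}. C j)"
      by (simp add: sum_distrib_left of_nat_diff Suc_leI)
    also have "(\<Sum>j\<in>UNIV - {i}. C j) = (\<Sum>j\<in>UNIV. C j) - C i"
      by (simp add: sum_diff1)
    also have "(\<Sum>j\<in>UNIV. C j) = (LINT y|?M. (\<Sum>j\<in>UNIV. (y $ j)\<^sup>2 * cos (t * y $ i)))"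
      unfolding C_def by (rule Bochner_Integration.integral_sum[symmetric]) (rule int)
    also have "\<dots> = sphere_cos i t"
      unfolding sphere_cos_def
      by (rule Bochner_Integration.integral_cong)
         (simp_all add: sum_components_squared_on_sphere flip: sum_distrib_right)
    finally show ?thesis
      by (simp add: \<Phi>'_def \<Phi>''_def S_def C_def algebra_simps)
  qed
  have "0 \<le> real CARD('n) - 1" "real CARD('n) - 1 \<le> 2"
    using n zero_less_card_finite[where 'a = 'n] by linarith+
  then obtain K where "\<And>t. t \<ge> 1 \<Longrightarrow> \<bar>sphere_cos i t\<bar> \<le> K * t powr (- (real CARD('n) - 1) / 2)"
    using bessel_type_ode_decay[OF _ _ d1 d2 ode] by blast
  then show ?thesis
    by (intro that[of K]) simp
qed

text \<open>
  The reflection \<open>y \<mapsto> - y\<close> cancels the imaginary part, and an orthogonal map that takes the axis \<open>i\<close> to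
  the direction of \<open>w\<close> brings the real part into the standard form.
\<close>

lemma integral_sphere_plane_wave:
  fixes w :: "real ^ 'n" and i :: 'n
  shows "(LINT y|sphere_measure. exp (\<i> * of_real (w \<bullet> y))) = of_real (sphere_cos i (norm w))"
proof -
  let ?M = "sphere_measure :: (real ^ 'n) measure"
  have m: "(\<lambda>y. f (v \<bullet> y)) \<in> borel_measurable borel" if "continuous_on UNIV f"
    for f :: "real \<Rightarrow> 'b::metric_space" and v :: "real ^ 'n"
    by (intro borel_measurable_continuous_onI continuous_on_compose2[OF that] continuous_intros) auto
  have int: "integrable ?M (\<lambda>y. cos (w \<bullet> y))" "integrable ?M (\<lambda>y. sin (w \<bullet> y))"
    by (intro integrable_sphere_bounded[where C = 1] m continuous_intros; simp)+
  have "(LINT y|?M. sin (w \<bullet> - y)) = (LINT y|?M. sin (w \<bullet> y))"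
    by (rule integral_sphere_orthogonal)
       (auto intro: m continuous_intros simp: orthogonal_transformation_neg)
  then have sin0: "(LINT y|?M. sin (w \<bullet> y)) = 0"
    by simp
  have "norm (norm w *\<^sub>R axis i 1 :: real ^ 'n) = norm w"
    by simp
  then obtain R :: "real ^ 'n \<Rightarrow> real ^ 'n"
    where R: "orthogonal_transformation R" "R (norm w *\<^sub>R axis i 1) = w"
    by (rule orthogonal_transformation_exists) (rule that)
  have "w \<bullet> R y = norm w * y $ i" for y
  proof -
    have "w \<bullet> R y = R (norm w *\<^sub>R axis i 1) \<bullet> R y"
      by (simp only: R(2))
    also have "\<dots> = (norm w *\<^sub>R axis i 1) \<bullet> y"
      using R(1) unfolding orthogonal_transformation_def by blast
    finally show ?thesis
      by (simp add: inner_axis')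
  qed
  then have "(LINT y|?M. cos (norm w * y $ i)) = (LINT y|?M. cos (w \<bullet> R y))"
    by simp
  also have "\<dots> = (LINT y|?M. cos (w \<bullet> y))"
    by (rule integral_sphere_orthogonal[OF R(1)]) (intro m continuous_intros)
  finally have cos: "(LINT y|?M. cos (w \<bullet> y)) = sphere_cos i (norm w)"
    by (simp add: sphere_cos_def)
  have "(LINT y|?M. exp (\<i> * of_real (w \<bullet> y))) =
      (LINT y|?M. of_real (cos (w \<bullet> y)) + \<i> * of_real (sin (w \<bullet> y)))"
    by (simp add: exp_Euler cos_of_real sin_of_real)
  also have "\<dots> = of_real (LINT y|?M. cos (w \<bullet> y)) + \<i> * of_real (LINT y|?M. sin (w \<bullet> y))"
    using int by simp
  finally show ?thesis
    by (simp add: cos sin0)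
qed

section \<open>Decay of the imaging functional\<close>

theorem theorem3p2:
  fixes \<Omega> D \<X> :: "(real ^ 'd) set"
    and x :: "nat \<Rightarrow> real ^ 'd"
    and B Dj :: "nat \<Rightarrow> (real ^ 'd) set"
    and \<rho> :: "real ^ 'd \<Rightarrow> complex"
    and J :: nat
    and k \<epsilon> c\<^sub>0 :: real
  assumes "CARD('d) \<in> {2, 3}"
    and "k > 0"
    and "J \<ge> 1"
    and "open \<Omega>" "bounded \<Omega>" "simply_connected \<Omega>" "lipschitz_boundary \<Omega>"
    and "\<And>j. j \<in> {1..J} \<Longrightarrow> x j \<in> \<Omega>"
    and "c\<^sub>0 > 0"
    and "\<And>i j. i \<in> {1..J} \<Longrightarrow> j \<in> {1..J} \<Longrightarrow> i \<noteq> j \<Longrightarrow> dist (x i) (x j) \<ge> c\<^sub>0"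
    and "\<And>j. j \<in> {1..J} \<Longrightarrow> bounded_lipschitz_domain (B j)"
    and "\<And>j. j \<in> {1..J} \<Longrightarrow> centered_at_origin (B j)"
    and "0 < \<epsilon>" "\<epsilon> < 1"
    and Dj: "Dj = (\<lambda>j. region \<epsilon> (x j) (B j))"
    and D: "D = (\<Union>j\<in>{1..J}. Dj j)"
    and "disjoint_family_on Dj {1..J}"
    and "D \<subseteq> \<Omega>" "setdist D (frontier \<Omega>) > 0"
    and "Linfty_on D \<rho>"
    and "\<And>j. j \<in> {1..J} \<Longrightarrow> Avg \<rho> (Dj j) \<noteq> 0"
    and X: "\<X> = {x j | j. j \<in> {1..J}}"
  shows "W\<^sub>0 k \<epsilon> J x B \<rho>
    \<in> O[inf (filtercomap (\<lambda>z. infdist z \<X>) at_top) (principal (UNIV - D))](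
        \<lambda>z. infdist z \<X> powr ((1 - real CARD('d)) / 2))"
proof -
  define p where "p = (1 - real CARD('d)) / 2"
  have p: "p \<le> 0"
    using assms(1) by (auto simp: p_def)
  \<comment> \<open>The choice of the axis is immaterial: the plane wave integral is radial.\<close>
  fix i :: 'd
  have "CARD('d) \<le> 3"
    using assms(1) by auto
  then obtain K where K: "\<And>t. t \<ge> 1 \<Longrightarrow> \<bar>sphere_cos i t\<bar> \<le> K * t powr p"
    unfolding p_def by (rule sphere_cos_decay[of i]) blast
  have K0: "0 \<le> K"
    using K[of 1] by simp
  define c where "c j = Avg \<rho> (region \<epsilon> (x j) (B j)) * of_real (measure lebesgue (B j))" for j
  have wave: "norm (LINT y|sphere_measure. exp (\<i> * of_real (k * ((x j - z) \<bullet> y))))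
      \<le> K * k powr p * infdist z \<X> powr p"
    if j: "j \<in> {1..J}" and z: "infdist z \<X> \<ge> 1 / k" for j z
  proof -
    have "infdist z \<X> \<le> dist z (x j)"
      using j X by (intro infdist_le) auto
    then have le: "k * infdist z \<X> \<le> k * norm (x j - z)"
      using \<open>k > 0\<close> by (simp add: dist_norm norm_minus_commute)
    have ge1: "1 \<le> k * infdist z \<X>"
      using z \<open>k > 0\<close> by (simp add: field_simps)
    have "(LINT y|sphere_measure. exp (\<i> * of_real (k * ((x j - z) \<bullet> y)))) =
        of_real (sphere_cos i (norm (k *\<^sub>R (x j - z))))"
      using integral_sphere_plane_wave[of "k *\<^sub>R (x j - z)" i] by simp
    then have "norm (LINT y|sphere_measure. exp (\<i> * of_real (k * ((x j - z) \<bullet> y)))) =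
        \<bar>sphere_cos i (k * norm (x j - z))\<bar>"
      using \<open>k > 0\<close> by simp
    also have "\<dots> \<le> K * (k * norm (x j - z)) powr p"
      using le ge1 by (intro K) simp
    also have "\<dots> \<le> K * (k * infdist z \<X>) powr p"
      using p le ge1 K0 by (intro mult_left_mono[OF powr_mono2']) linarith+
    also have "\<dots> = K * k powr p * infdist z \<X> powr p"
      using \<open>k > 0\<close> by (simp add: powr_mult infdist_nonneg)
    finally show ?thesis .
  qed
  have "norm (W\<^sub>0 k \<epsilon> J x B \<rho> z) \<le>
      (\<epsilon> ^ CARD('d) * (\<Sum>j=1..J. norm (c j)) * (K * k powr p)) * norm (infdist z \<X> powr p)"
    if z: "infdist z \<X> \<ge> 1 / k" for z
  proof -
    have "norm (W\<^sub>0 k \<epsilon> J x B \<rho> z) = \<epsilon> ^ CARD('d) * norm (\<Sum>j=1..J. c j *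
        (LINT y|sphere_measure. exp (\<i> * of_real (k * ((x j - z) \<bullet> y)))))"
      using \<open>0 < \<epsilon>\<close> by (simp add: W\<^sub>0_def c_def norm_mult norm_power)
    also have "\<dots> \<le> \<epsilon> ^ CARD('d) * (\<Sum>j=1..J. norm (c j) * (K * k powr p * infdist z \<X> powr p))"
      using \<open>0 < \<epsilon>\<close> wave[OF _ z]
      by (intro mult_left_mono sum_norm_le) (auto simp: norm_mult intro!: mult_left_mono)
    finally show ?thesis
      by (simp add: sum_distrib_right mult.assoc)
  qed
  moreover have "eventually (\<lambda>z. infdist z \<X> \<ge> 1 / k) (filtercomap (\<lambda>z. infdist z \<X>) at_top)"
    by (rule eventually_filtercomapI) (rule eventually_ge_at_top)
  ultimately show ?thesis
    unfolding p_def[symmetric]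
    by (intro bigoI[where c = "\<epsilon> ^ CARD('d) * (\<Sum>j=1..J. norm (c j)) * (K * k powr p)"])
       (auto intro: filter_leD[OF inf_le1] elim!: eventually_mono)
qed

end
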